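(* Let a bottom network, a template network (with bijection $f$ from its input interface nodes to its output interface nodes) and a top network be given, all over $n$ binary variables per slice and all with $k$ interface nodes. Suppose that: (a) the bottom network is complete and decomposable; (b) the scopes of all pairs of output interface nodes of the bottom network are either identical or disjoint; (c) the scopes of the output interface nodes of the bottom network can be used to assign scopes to the input interface nodes of the template network and of the top network (each input interface node receiving the scope of the corresponding output interface node of the bottom network) in such a way that the template network is invariant and the top network is complete and decomposable. Then the corresponding DSPN (dynamic sum-product network) is complete and decomposable, for every number $T\ge 1$ of slices.
   Context: **Networks and scopes.** All networks are finite directed acyclic graphs whose internal nodes are sum nodes or product nodes; each edge $(i,j)$ leaving a sum node has a non-negative weight $w_{ij}$. For each slice $t=1,2,\dots$ there are binary variables $X_1^t,\dots,X_n^t$ (all distinct for different $(i,t)$), with indicator leaves $I_{x_i^t}$ and $I_{\bar x_i^t}$. The scope of a node is the set of variables appearing in the sub-network rooted at it: the scope of an indicator leaf $I_{x_i^t}$ or $I_{\bar x_i^t}$ is $\{X_i^t\}$, a leaf that is an input interface node has a scope assigned to it (a set of variables), and the scope of an internal node is the union of the scopes of its children. A sum node is complete if all its children have the same scope; a product node is decomposable if its children have pairwise disjoint scopes. A network is complete if all its sum nodes are complete and decomposable if all its product nodes are decomposable. **Template network** for slice $t$: a directed acyclic graph with $k$ roots and $k+2n$ leaves. $2n$ of the leaves are the indicators $I_{x_1^t},\dots,I_{x_n^t},I_{\bar x_1^t},\dots,I_{\bar x_n^t}$. The remaining $k$ leaves are the input interface nodes and the $k$ roots are the output interface nodes; interface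 and interior nodes are sum or product nodes. A bijection $f$ from the input interface nodes to the output interface nodes is part of the data. The template for another slice is obtained by replacing the variables $X_i^t$ by those of that slice. **Bottom network**: a directed acyclic graph with $k$ roots (output interface nodes) and $2n$ leaves, the indicators of the first-slice variables $X_1^1,\dots,X_n^1$; interface and interior nodes are sum or product nodes. Its roots are in bijective correspondence with the input interface nodes of the template. **Top network**: a rooted directed acyclic graph of sum and product nodes with $k$ leaves, which are its input interface nodes; these are also in bijective correspondence with the input interface nodes of the template. **DSPN of $T$ slices**: obtained by stacking $T-1$ copies of the template network (for slices $2,\dots,T$) on top of the bottom network and capping with the top network. Two networks are stacked by merging the input interface nodes of the upper network with the output interface nodes of the lower network: an output interface node of the bottom network is merged with the corresponding input interface node of the network above it, and the output interface node $f(i)$ of a template copy is merged with the input interface node of the network above it corresponding to $i$. A merged node keeps the type and children of the lower network's output node. **Invariance.** A template network over $X_1^t,\dots,X_n^t$, with scopes assigned to its input interface nodes, is invariant when the scope of each input interface node excludes the variables $X_1^t,\dots,X_n^t$ and for all pairs $i,j$ of input interface nodes: 1. $scope(i)=scope(j)$ or $scope(i)\cap scope(j)=\emptyset$; 2. $scope(i)=scope(j)\iff scope(f(i))=scope(f(j))$; 3. $scope(i)\cap scope(j)=\emptyset\iff scope(f(i))\cap scope(f(j))=\emptyset$; 4. all interior and output sum nodes are complete; 5. all interior and output product nodes are decomposable. *)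

theory Defs
  imports Complex_Main
begin

section \<open>Sum-product networks with interface leaves\<close>

text \<open>The pair \<open>(i, t)\<close> stands for the binary variable \<open>X\<^sub>i\<^sup>t\<close>.\<close>

type_synonym var = "nat \<times> nat"

definition slice_vars :: "nat \<Rightarrow> nat \<Rightarrow> var set" where
  "slice_vars n t = {1..n} \<times> {t}"

text \<open>\<open>Indicator x True\<close> is the indicator of the positive literal of \<open>x\<close>, \<open>Indicator x False\<close> the
  indicator of the negative literal. An input interface node has no sum/product type of its own:
  it has no children, and in a stack it takes over the type and the children of the node it is
  merged with.\<close>

datatype node_label = Indicator var bool | InputNode | SumNode | ProdNode

text \<open>Arcs point from parent to child; \<open>weight N u v\<close> is meaningful only if \<open>(u, v)\<close> is an arc
  leaving a sum node.\<close>

record 'v network =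
  nodes :: "'v set"
  arcs :: "('v \<times> 'v) set"
  label :: "'v \<Rightarrow> node_label"
  weight :: "'v \<Rightarrow> 'v \<Rightarrow> real"

definition roots :: "'v network \<Rightarrow> 'v set" where
  "roots N = {v \<in> nodes N. \<forall>u. (u, v) \<notin> arcs N}"

definition leaves :: "'v network \<Rightarrow> 'v set" where
  "leaves N = {v \<in> nodes N. \<forall>u. (v, u) \<notin> arcs N}"

definition inputs :: "'v network \<Rightarrow> 'v set" where
  "inputs N = {v \<in> nodes N. label N v = InputNode}"

definition indicators :: "'v network \<Rightarrow> 'v set" where
  "indicators N = {v \<in> nodes N. \<exists>x b. label N v = Indicator x b}"

definition is_network :: "'v network \<Rightarrow> bool" where
  "is_network N \<longleftrightarrow>
     finite (nodes N) \<and> arcs N \<subseteq> nodes N \<times> nodes N \<and> acyclic (arcs N) \<and>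
     leaves N = inputs N \<union> indicators N \<and>
     (\<forall>u v. (u, v) \<in> arcs N \<and> label N u = SumNode \<longrightarrow> 0 \<le> weight N u v)"

definition has_slice_indicators :: "nat \<Rightarrow> nat \<Rightarrow> 'v network \<Rightarrow> bool" where
  "has_slice_indicators n t N \<longleftrightarrow>
     bij_betw (label N) (indicators N) {Indicator x b | x b. x \<in> slice_vars n t}"

text \<open>The output interface nodes of a bottom or template network are its roots. Being interface
  nodes, they are not indicators. A template root may be an input interface node at the same
  time (a node without parents and children); stacking then merges more than two nodes.\<close>

definition is_bottom :: "nat \<Rightarrow> nat \<Rightarrow> 'v network \<Rightarrow> bool" where
  "is_bottom n k N \<longleftrightarrow>
     is_network N \<and> inputs N = {} \<and> has_slice_indicators n 1 N \<and>
     card (roots N) = k \<and> roots N \<inter> indicators N = {}"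

definition is_template :: "nat \<Rightarrow> nat \<Rightarrow> nat \<Rightarrow> 'v network \<Rightarrow> ('v \<Rightarrow> 'v) \<Rightarrow> bool" where
  "is_template n k t N f \<longleftrightarrow>
     is_network N \<and> card (inputs N) = k \<and> has_slice_indicators n t N \<and>
     card (roots N) = k \<and> roots N \<inter> indicators N = {} \<and>
     bij_betw f (inputs N) (roots N)"

definition is_top :: "nat \<Rightarrow> 'v network \<Rightarrow> bool" where
  "is_top k N \<longleftrightarrow>
     is_network N \<and> card (inputs N) = k \<and> indicators N = {} \<and> card (roots N) = 1"

section \<open>Scopes, completeness, decomposability, invariance\<close>

text \<open>The parameter \<open>\<sigma>\<close> assigns scopes to the input interface nodes; its values elsewhere are
  irrelevant.\<close>

definition leaf_scope :: "('v \<Rightarrow> var set) \<Rightarrow> 'v network \<Rightarrow> 'v \<Rightarrow> var set" where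
  "leaf_scope \<sigma> N v =
     (case label N v of Indicator x b \<Rightarrow> {x} | InputNode \<Rightarrow> \<sigma> v | SumNode \<Rightarrow> {} | ProdNode \<Rightarrow> {})"

definition scope :: "('v \<Rightarrow> var set) \<Rightarrow> 'v network \<Rightarrow> 'v \<Rightarrow> var set" where
  "scope \<sigma> N v = (\<Union>u \<in> {u. (v, u) \<in> (arcs N)\<^sup>*}. leaf_scope \<sigma> N u)"

lemma scope_unfold:
  "scope \<sigma> N v = leaf_scope \<sigma> N v \<union> (\<Union>c \<in> {c. (v, c) \<in> arcs N}. scope \<sigma> N c)"
proof -
  have "{u. (v, u) \<in> (arcs N)\<^sup>*} = insert v (\<Union>c \<in> {c. (v, c) \<in> arcs N}. {u. (c, u) \<in> (arcs N)\<^sup>*})"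
    by (auto intro: converse_rtrancl_into_rtrancl elim: converse_rtranclE)
  then show ?thesis
    unfolding scope_def by auto
qed

lemma scope_internal:
  "label N v \<in> {SumNode, ProdNode} \<Longrightarrow> scope \<sigma> N v = (\<Union>c \<in> {c. (v, c) \<in> arcs N}. scope \<sigma> N c)"
  by (subst scope_unfold) (auto simp: leaf_scope_def)

lemma scope_leaf:
  "v \<in> leaves N \<Longrightarrow> scope \<sigma> N v = leaf_scope \<sigma> N v"
  by (subst scope_unfold) (auto simp: leaves_def)

definition complete_net :: "('v \<Rightarrow> var set) \<Rightarrow> 'v network \<Rightarrow> bool" where
  "complete_net \<sigma> N \<longleftrightarrow>
     (\<forall>v \<in> nodes N. label N v = SumNode \<longrightarrow>
        (\<forall>c d. (v, c) \<in> arcs N \<and> (v, d) \<in> arcs N \<longrightarrow> scope \<sigma> N c = scope \<sigma> N d))"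

definition decomposable_net :: "('v \<Rightarrow> var set) \<Rightarrow> 'v network \<Rightarrow> bool" where
  "decomposable_net \<sigma> N \<longleftrightarrow>
     (\<forall>v \<in> nodes N. label N v = ProdNode \<longrightarrow>
        (\<forall>c d. (v, c) \<in> arcs N \<and> (v, d) \<in> arcs N \<and> c \<noteq> d \<longrightarrow> scope \<sigma> N c \<inter> scope \<sigma> N d = {}))"

text \<open>The scope assignment used for networks without input interface nodes.\<close>

abbreviation no_inputs :: "'v \<Rightarrow> var set" where
  "no_inputs \<equiv> \<lambda>_. {}"

definition invariant :: "nat \<Rightarrow> nat \<Rightarrow> ('v \<Rightarrow> var set) \<Rightarrow> 'v network \<Rightarrow> ('v \<Rightarrow> 'v) \<Rightarrow> bool" where
  "invariant n t \<sigma> N f \<longleftrightarrow>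
     (\<forall>i \<in> inputs N. scope \<sigma> N i \<inter> slice_vars n t = {}) \<and>
     (\<forall>i \<in> inputs N. \<forall>j \<in> inputs N.
        (scope \<sigma> N i = scope \<sigma> N j \<or> scope \<sigma> N i \<inter> scope \<sigma> N j = {}) \<and>
        (scope \<sigma> N i = scope \<sigma> N j \<longleftrightarrow> scope \<sigma> N (f i) = scope \<sigma> N (f j)) \<and>
        (scope \<sigma> N i \<inter> scope \<sigma> N j = {} \<longleftrightarrow> scope \<sigma> N (f i) \<inter> scope \<sigma> N (f j) = {})) \<and>
     complete_net \<sigma> N \<and> decomposable_net \<sigma> N"

section \<open>Stacking\<close>

fun set_slice :: "nat \<Rightarrow> node_label \<Rightarrow> node_label" where
  "set_slice s (Indicator (i, t) b) = Indicator (i, s) b"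
| "set_slice s l = l"

definition at_slice :: "nat \<Rightarrow> 'v network \<Rightarrow> 'v network" where
  "at_slice s N = N\<lparr>label := set_slice s \<circ> label N\<rparr>"

definition image_net :: "('u \<Rightarrow> 'v) \<Rightarrow> 'u network \<Rightarrow> 'v network" where
  "image_net e N =
     \<lparr>nodes = e ` nodes N,
      arcs = map_prod e e ` arcs N,
      label = (\<lambda>v. label N (inv_into (nodes N) e v)),
      weight = (\<lambda>u v. weight N (inv_into (nodes N) e u) (inv_into (nodes N) e v))\<rparr>"

text \<open>\<open>place U m c\<close> says where the nodes of an upper network \<open>U\<close> go in a stack: an input interface
  node \<open>i\<close> is merged with the node \<open>m i\<close> of the lower network, every other node \<open>v\<close> becomes
  the fresh node \<open>c v\<close>.\<close>

definition place :: "'u network \<Rightarrow> ('u \<Rightarrow> 'v) \<Rightarrow> ('u \<Rightarrow> 'v) \<Rightarrow> 'u \<Rightarrow> 'v" where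
  "place U m c v = (if v \<in> inputs U then m v else c v)"

definition stack :: "('u \<Rightarrow> 'v) \<Rightarrow> 'u network \<Rightarrow> 'v network \<Rightarrow> 'v network" where
  "stack e U L =
     \<lparr>nodes = nodes L \<union> nodes (image_net e U),
      arcs = arcs L \<union> arcs (image_net e U),
      label = (\<lambda>v. if v \<in> nodes L then label L v else label (image_net e U) v),
      weight = (\<lambda>u v. if u \<in> nodes L then weight L u v else weight (image_net e U) u v)\<rparr>"

datatype ('a, 'b, 'c) dspn_node = BotNode 'a | TemplateNode nat 'b | TopNode 'c

text \<open>In the following, \<open>g\<close> maps the template inputs to the corresponding roots of the bottom
  network and \<open>h\<close> maps the inputs of the top network to the corresponding template inputs.
  \<open>tower g f B P m\<close> consists of the bottom network \<open>B\<close> and \<open>m\<close> copies of the template \<open>P\<close>, for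
  the slices \<open>2, \<dots>, m + 1\<close>; \<open>iface g f P m i\<close> is its output interface node that is merged
  with the next input interface node corresponding to the template input \<open>i\<close>.\<close>

primrec iface ::
  "('b \<Rightarrow> 'a) \<Rightarrow> ('b \<Rightarrow> 'b) \<Rightarrow> 'b network \<Rightarrow> nat \<Rightarrow> 'b \<Rightarrow> ('a, 'b, 'c) dspn_node" where
  "iface g f P 0 = (\<lambda>i. BotNode (g i))"
| "iface g f P (Suc m) = (\<lambda>i. place P (iface g f P m) (TemplateNode (m + 2)) (f i))"

primrec tower ::
  "('b \<Rightarrow> 'a) \<Rightarrow> ('b \<Rightarrow> 'b) \<Rightarrow> 'a network \<Rightarrow> 'b network \<Rightarrow> nat \<Rightarrow> ('a, 'b, 'c) dspn_node network" where
  "tower g f B P 0 = image_net BotNode B"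
| "tower g f B P (Suc m) =
     stack (place P (iface g f P m) (TemplateNode (m + 2))) (at_slice (m + 2) P) (tower g f B P m)"

definition dspn ::
  "('b \<Rightarrow> 'a) \<Rightarrow> ('b \<Rightarrow> 'b) \<Rightarrow> ('c \<Rightarrow> 'b) \<Rightarrow> 'a network \<Rightarrow> 'b network \<Rightarrow> 'c network \<Rightarrow> nat \<Rightarrow>
    ('a, 'b, 'c) dspn_node network" where
  "dspn g f h B P R T =
     stack (place R (iface g f P (T - 1) \<circ> h) TopNode) R (tower g f B P (T - 1))"

text \<open>No \<open>InputNode\<close> label survives stacking, so the assignment \<open>no_inputs\<close> never contributes to
  a scope in a DSPN.\<close>

lemma at_slice_simps [simp]:
  "nodes (at_slice s N) = nodes N" "arcs (at_slice s N) = arcs N"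
  "label (at_slice s N) v = set_slice s (label N v)"
  "weight (at_slice s N) = weight N"
  by (simp_all add: at_slice_def)

lemma set_slice_eq_InputNode [simp]: "set_slice s l = InputNode \<longleftrightarrow> l = InputNode"
  by (cases "(s, l)" rule: set_slice.cases) auto

lemma inputs_at_slice [simp]: "inputs (at_slice s N) = inputs N"
  by (simp add: inputs_def)

lemma inputs_stack:
  assumes "inputs L = {}" and "\<And>i. i \<in> inputs U \<Longrightarrow> e i \<in> nodes L"
  shows "inputs (stack e U L) = {}"
proof -
  have False if v: "v \<in> e ` nodes U" "v \<notin> nodes L"
    and l: "label U (inv_into (nodes U) e v) = InputNode" for v
  proof -
    let ?u = "inv_into (nodes U) e v"
    have "?u \<in> nodes U" "e ?u = v"
      using v(1) by (rule inv_into_into, rule f_inv_into_f)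
    with l assms(2)[of ?u] v(2) show False
      by (simp add: inputs_def)
  qed
  with assms(1) show ?thesis
    by (auto simp: stack_def image_net_def inputs_def)
qed

lemma iface_in_tower:
  assumes "g ` inputs P \<subseteq> nodes B" and "f ` inputs P \<subseteq> nodes P" and "i \<in> inputs P"
  shows "iface g f P m i \<in> nodes (tower g f B P m)"
  using assms by (cases m) (auto simp: image_net_def stack_def)

lemma inputs_tower:
  assumes "inputs B = {}" and "g ` inputs P \<subseteq> nodes B" and "f ` inputs P \<subseteq> nodes P"
  shows "inputs (tower g f B P m) = {}"
proof (induction m)
  case 0
  show ?case
    using assms(1) by (auto simp: image_net_def inputs_def inj_on_def)
next
  case (Suc m)
  then show ?case
    by (auto intro!: inputs_stack iface_in_tower[OF assms(2,3)] simp: place_def)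
qed

lemma inputs_dspn:
  assumes "inputs B = {}" and "g ` inputs P \<subseteq> nodes B" and "f ` inputs P \<subseteq> nodes P"
    and "h ` inputs R \<subseteq> inputs P"
  shows "inputs (dspn g f h B P R T) = {}"
  unfolding dspn_def
  by (intro inputs_stack inputs_tower[OF assms(1-3)])
     (use assms(4) in \<open>auto simp: place_def intro!: iface_in_tower[OF assms(2,3)]\<close>)

end

theory Submission
  imports Defs
begin

text \<open>The scope of a node of a network that sits in a stack is its scope in the isolated network
  when every input interface node is assigned the scope of the node it is merged with. This scope is
  the union of the scopes of the reachable inputs and of the variables of the reachable indicators.
  If the input scopes are nonempty, pairwise equal or disjoint, and avoid the variables of the
  slice, then whether two nodes have equal or disjoint scopes depends only on which inputs have
  equal and which have disjoint scopes. Invariance says that \<open>f\<close> reproduces this pattern, so by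
  induction every copy of the template, and the top network, sees the pattern of the bottom network.\<close>

section \<open>Scopes in a stack\<close>

lemma leaf_scope_subset_scope: "leaf_scope \<sigma> N v \<subseteq> scope \<sigma> N v"
  by (subst scope_unfold) auto

lemma scope_mono_reachable: "(u, v) \<in> (arcs N)\<^sup>* \<Longrightarrow> scope \<sigma> N v \<subseteq> scope \<sigma> N u"
  by (auto simp: scope_def intro: rtrancl_trans)

text \<open>\<open>e\<close> glues the inputs of \<open>U\<close> to nodes of \<open>L\<close> and
  sends the other nodes injectively to new ones. The assumptions speak of \<open>e\<close> rather
  than of \<open>place\<close>, so that the bottom network, embedded over an empty lower network, is
  an instance as well.\<close>

locale stacking =
  fixes e :: "'u \<Rightarrow> 'v" and U :: "'u network" and L :: "'v network"
  assumes arcs_U: "arcs U \<subseteq> nodes U \<times> nodes U"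
    and inputs_leaves: "inputs U \<subseteq> leaves U"
    and arcs_L: "arcs L \<subseteq> nodes L \<times> nodes L"
    and merged: "e ` inputs U \<subseteq> nodes L"
    and inj: "inj_on e (nodes U - inputs U)"
    and fresh: "e ` (nodes U - inputs U) \<inter> nodes L = {}"
begin

abbreviation "S \<equiv> stack e U L"

lemma nodes_S: "nodes S = nodes L \<union> e ` nodes U"
  by (simp add: stack_def image_net_def)

lemma arcs_S: "arcs S = arcs L \<union> map_prod e e ` arcs U"
  by (simp add: stack_def image_net_def)

lemma arcs_S_subset: "arcs S \<subseteq> nodes S \<times> nodes S"
  using arcs_L arcs_U by (auto simp: nodes_S arcs_S)

lemma label_lower: "v \<in> nodes L \<Longrightarrow> label S v = label L v"
  by (simp add: stack_def)

lemma input_iff: "u \<in> nodes U \<Longrightarrow> e u \<in> nodes L \<longleftrightarrow> u \<in> inputs U"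
  using merged fresh by auto

text \<open>\<open>image_net\<close> reads labels through \<open>inv_into\<close> on all of
  \<open>nodes U\<close>, where \<open>e\<close> need not be injective. The image of a non-input
  lies outside \<open>L\<close>, so each of its preimages is again a non-input and
  \<open>inj\<close> applies.\<close>

lemma upper_unique:
  assumes "u \<in> nodes U" "u \<notin> inputs U" "w \<in> nodes U" "e w = e u"
  shows "w = u"
proof -
  have "w \<notin> inputs U"
    using assms input_iff by metis
  with assms inj show ?thesis
    by (auto dest: inj_onD)
qed

lemma label_upper:
  assumes "u \<in> nodes U" "u \<notin> inputs U"
  shows "label S (e u) = label U u"
proof -
  have "inv_into (nodes U) e (e u) = u"
    using assms by (intro upper_unique) (auto intro: inv_into_into f_inv_into_f)
  then show ?thesis
    using assms by (simp add: stack_def image_net_def input_iff)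
qed

text \<open>A merged input is a leaf of \<open>U\<close>, so \<open>U\<close> contributes no arc out
  of a node of \<open>L\<close>.\<close>

lemma arc_lower:
  assumes "v \<in> nodes L"
  shows "(v, w) \<in> arcs S \<longleftrightarrow> (v, w) \<in> arcs L"
proof -
  have False if "(a, b) \<in> arcs U" "e a = v" for a b
  proof -
    have "a \<in> inputs U"
      using that arcs_U assms input_iff by auto
    with that inputs_leaves show False
      by (auto simp: leaves_def)
  qed
  then show ?thesis
    by (auto simp: arcs_S)
qed

lemma arc_upper:
  assumes "u \<in> nodes U" "u \<notin> inputs U" "(e u, w) \<in> arcs S"
  obtains c where "(u, c) \<in> arcs U" "w = e c"
proof -
  have "(e u, w) \<notin> arcs L"
    using assms arcs_L input_iff by auto
  then obtain a c where "(a, c) \<in> arcs U" "e a = e u" "w = e c"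
    using assms(3) by (auto simp: arcs_S)
  moreover have "a = u"
    using calculation assms arcs_U by (intro upper_unique) auto
  ultimately show ?thesis
    using that by simp
qed

lemma reachable_lower:
  assumes "(v, w) \<in> (arcs S)\<^sup>*" "v \<in> nodes L"
  shows "(v, w) \<in> (arcs L)\<^sup>* \<and> w \<in> nodes L"
  using assms
proof (induction rule: rtrancl_induct)
  case (step y z)
  then show ?case
    using arc_lower arcs_L by (auto intro: rtrancl_into_rtrancl)
qed simp

lemma scope_lower:
  assumes "v \<in> nodes L"
  shows "scope \<tau> S v = scope \<tau> L v"
proof -
  have reach: "{w. (v, w) \<in> (arcs S)\<^sup>*} = {w. (v, w) \<in> (arcs L)\<^sup>*}"
    using reachable_lower[OF _ assms] rtrancl_mono[of "arcs L" "arcs S"]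
    by (auto simp: arcs_S)
  have "leaf_scope \<tau> S w = leaf_scope \<tau> L w" if "(v, w) \<in> (arcs S)\<^sup>*" for w
    using reachable_lower[OF that assms] by (simp add: leaf_scope_def label_lower)
  with reach show ?thesis
    unfolding scope_def by auto
qed

text \<open>A downward path from \<open>e u\<close> either stays among the non-inputs of
  \<open>U\<close> or enters \<open>L\<close> at a merged input \<open>i\<close>, below which
  exactly \<open>\<sigma> i\<close> is collected.\<close>

lemma scope_upper:
  assumes \<sigma>: "\<And>i. i \<in> inputs U \<Longrightarrow> scope \<tau> L (e i) = \<sigma> i" and "u \<in> nodes U"
  shows "scope \<tau> S (e u) = scope \<sigma> U u"
proof
  have leaf: "leaf_scope \<tau> S (e w) = leaf_scope \<sigma> U w" if "w \<in> nodes U" "w \<notin> inputs U" for w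
    using that by (auto simp: leaf_scope_def label_upper inputs_def split: node_label.split)
  have input: "scope \<tau> S (e w) = leaf_scope \<sigma> U w" if "w \<in> inputs U" for w
    using that merged by (subst scope_lower) (auto simp: leaf_scope_def inputs_def \<sigma>)
  have "leaf_scope \<tau> S x \<subseteq> scope \<sigma> U u" if "(e u, x) \<in> (arcs S)\<^sup>*" for x
    using that assms(2)
  \<comment> \<open>The path is shortened at its start. At an input, the scope of the merged node
    accounts for the whole remaining path; at a non-input, the first arc stems from \<open>U\<close>
    and the hypothesis applies to its target.\<close>
  proof (induction "e u" arbitrary: u rule: converse_rtrancl_induct)
    case base
    then show ?case
      using leaf[of u] input[of u] leaf_scope_subset_scope[of \<sigma> U u]
        leaf_scope_subset_scope[of \<tau> S "e u"] by blast
  next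
    case (step z)
    show ?case
    proof (cases "u \<in> inputs U")
      case True
      have "(e u, x) \<in> (arcs S)\<^sup>*"
        using step.hyps by (blast intro: converse_rtrancl_into_rtrancl)
      then have "leaf_scope \<tau> S x \<subseteq> scope \<tau> S (e u)"
        by (auto simp: scope_def)
      then show ?thesis
        using input[OF True] leaf_scope_subset_scope[of \<sigma> U u] by blast
    next
      case False
      obtain c where c: "(u, c) \<in> arcs U" "z = e c"
        using arc_upper[OF step.prems False step.hyps(1)] .
      then have "leaf_scope \<tau> S x \<subseteq> scope \<sigma> U c"
        using step.hyps(3) arcs_U by auto
      then show ?thesis
        using scope_mono_reachable[of u c U \<sigma>] c by blast
    qed
  qed
  then show "scope \<tau> S (e u) \<subseteq> scope \<sigma> U u"
    unfolding scope_def[of \<tau> S] by blast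
  \<comment> \<open>Conversely, paths of \<open>U\<close> map to paths of the stack, and an input at
    the end of one contributes the entire scope of its merged node.\<close>
  have "leaf_scope \<sigma> U w \<subseteq> scope \<tau> S (e u)" if "(u, w) \<in> (arcs U)\<^sup>*" for w
  proof -
    have "(e u, e w) \<in> (arcs S)\<^sup>* \<and> w \<in> nodes U"
      using that
    proof (induction rule: rtrancl_induct)
      case (step y z)
      then have "(e y, e z) \<in> arcs S"
        by (force simp: arcs_S)
      with step arcs_U show ?case
        by (auto intro: rtrancl_into_rtrancl)
    qed (use assms(2) in simp)
    then have "scope \<tau> S (e w) \<subseteq> scope \<tau> S (e u)" "w \<in> nodes U"
      by (auto dest: scope_mono_reachable)
    then show ?thesis
      using leaf[of w] input[of w] leaf_scope_subset_scope[of \<tau> S "e w"] by blast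
  qed
  then show "scope \<sigma> U u \<subseteq> scope \<tau> S (e u)"
    unfolding scope_def[of \<sigma> U] by blast
qed

section \<open>Completeness and decomposability of a stack\<close>

lemma node_cases:
  assumes "v \<in> nodes S"
  obtains "v \<in> nodes L" | u where "u \<in> nodes U" "u \<notin> inputs U" "v = e u"
  using assms input_iff by (auto simp: nodes_S)

text \<open>Every node of the stack takes its type and children from \<open>L\<close> or, if it is
  the image of a non-input, from \<open>U\<close>, and these children keep their scopes. A merged
  input counts as a node of \<open>L\<close>.\<close>

lemma complete_stack:
  assumes \<sigma>: "\<And>i. i \<in> inputs U \<Longrightarrow> scope \<tau> L (e i) = \<sigma> i"
    and "complete_net \<tau> L" "complete_net \<sigma> U"
  shows "complete_net \<tau> S"
  unfolding complete_net_def
proof (intro ballI impI allI, elim conjE)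
  fix v c d
  assume "v \<in> nodes S" and lab: "label S v = SumNode" and c: "(v, c) \<in> arcs S" and d: "(v, d) \<in> arcs S"
  then show "scope \<tau> S c = scope \<tau> S d"
  proof (cases rule: node_cases)
    case 1
    then have "(v, c) \<in> arcs L" "(v, d) \<in> arcs L" "label L v = SumNode"
      using c d lab by (auto simp: arc_lower label_lower)
    moreover from this arcs_L have "c \<in> nodes L" "d \<in> nodes L"
      by auto
    moreover have "scope \<tau> L c = scope \<tau> L d"
      using calculation 1 assms(2) unfolding complete_net_def by blast
    ultimately show ?thesis
      by (simp add: scope_lower)
  next
    case (2 u)
    obtain a b where ab: "(u, a) \<in> arcs U" "c = e a" "(u, b) \<in> arcs U" "d = e b"
      using arc_upper[OF 2(1,2)] c d 2(3) by metis
    then have "a \<in> nodes U" "b \<in> nodes U" "label U u = SumNode"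
      using arcs_U lab label_upper[OF 2(1,2)] 2(3) by auto
    moreover have "scope \<sigma> U a = scope \<sigma> U b"
      using calculation ab 2(1) assms(3) unfolding complete_net_def by blast
    ultimately show ?thesis
      using ab by (simp add: scope_upper[OF \<sigma>])
  qed
qed

text \<open>As for completeness; distinct children of an upper node come from distinct children in
  \<open>U\<close>, since \<open>e\<close> is a function.\<close>

lemma decomposable_stack:
  assumes \<sigma>: "\<And>i. i \<in> inputs U \<Longrightarrow> scope \<tau> L (e i) = \<sigma> i"
    and "decomposable_net \<tau> L" "decomposable_net \<sigma> U"
  shows "decomposable_net \<tau> S"
  unfolding decomposable_net_def
proof (intro ballI impI allI, elim conjE)
  fix v c d
  assume "v \<in> nodes S" and lab: "label S v = ProdNode" and c: "(v, c) \<in> arcs S" and d: "(v, d) \<in> arcs S"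
    and "c \<noteq> d"
  then show "scope \<tau> S c \<inter> scope \<tau> S d = {}"
  proof (cases rule: node_cases)
    case 1
    then have "(v, c) \<in> arcs L" "(v, d) \<in> arcs L" "label L v = ProdNode"
      using c d lab by (auto simp: arc_lower label_lower)
    moreover from this arcs_L have "c \<in> nodes L" "d \<in> nodes L"
      by auto
    ultimately show ?thesis
      using 1 assms(2) \<open>c \<noteq> d\<close> unfolding decomposable_net_def by (simp add: scope_lower)
  next
    case (2 u)
    obtain a b where ab: "(u, a) \<in> arcs U" "c = e a" "(u, b) \<in> arcs U" "d = e b"
      using arc_upper[OF 2(1,2)] c d 2(3) by metis
    then have "a \<in> nodes U" "b \<in> nodes U" "label U u = ProdNode" "a \<noteq> b"
      using arcs_U lab label_upper[OF 2(1,2)] 2(3) \<open>c \<noteq> d\<close> by auto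
    with ab 2(1) assms(3) show ?thesis
      unfolding decomposable_net_def by (simp add: scope_upper[OF \<sigma>])
  qed
qed

end

lemma stacking_place:
  assumes "is_network U" "arcs L \<subseteq> nodes L \<times> nodes L"
    and "m ` inputs U \<subseteq> nodes L" "inj c" "range c \<inter> nodes L = {}"
  shows "stacking (place U m c) U L"
proof
  show "place U m c ` (nodes U - inputs U) \<inter> nodes L = {}"
    using assms(5) by (auto simp: place_def)
  show "inj_on (place U m c) (nodes U - inputs U)"
    using assms(4) by (auto simp: place_def inj_on_def)
  show "place U m c ` inputs U \<subseteq> nodes L"
    using assms(3) by (auto simp: place_def)
  show "arcs U \<subseteq> nodes U \<times> nodes U" "inputs U \<subseteq> leaves U"
    using assms(1) unfolding is_network_def by blast+
qed fact

text \<open>A network without inputs is stacked on the empty network, so the base of the tower needs no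
  separate treatment.\<close>

definition empty_net :: "'v network" where
  "empty_net = \<lparr>nodes = {}, arcs = {}, label = (\<lambda>_. SumNode), weight = (\<lambda>_ _. 0)\<rparr>"

lemma image_net_eq_stack: "image_net e N = stack e N empty_net"
  by (rule network.equality) (simp_all add: stack_def image_net_def empty_net_def)

lemma stacking_empty_net:
  assumes "is_network N" "inputs N = {}" "inj e"
  shows "stacking e N empty_net"
proof
  show "arcs N \<subseteq> nodes N \<times> nodes N" "inputs N \<subseteq> leaves N"
    using assms(1) unfolding is_network_def by blast+
  show "inj_on e (nodes N - inputs N)"
    using assms(3) by (rule inj_on_subset) simp
qed (simp_all add: assms(2) empty_net_def)

lemma empty_net_simps [simp]:
  "arcs empty_net = {}" "complete_net \<sigma> empty_net" "decomposable_net \<sigma> empty_net"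
  by (simp_all add: empty_net_def complete_net_def decomposable_net_def)

section \<open>Changing the input scopes and the slice\<close>

text \<open>A relation instead of the function \<open>at_slice\<close>, so that it also links the
  top network to itself: without indicators there is no label to change.\<close>

definition reslice :: "nat \<Rightarrow> 'v network \<Rightarrow> 'v network \<Rightarrow> bool" where
  "reslice s N N' \<longleftrightarrow> nodes N' = nodes N \<and> arcs N' = arcs N \<and>
     (\<forall>v \<in> nodes N. label N' v = set_slice s (label N v))"

text \<open>Keeps from \<open>has_slice_indicators\<close> only where the variables lie, and so
  holds for any slice of a network without indicators.\<close>

definition in_slice :: "nat \<Rightarrow> nat \<Rightarrow> 'v network \<Rightarrow> bool" where
  "in_slice n t N \<longleftrightarrow> (\<forall>v \<in> nodes N. \<forall>x b. label N v = Indicator x b \<longrightarrow> x \<in> slice_vars n t)"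

lemma reslice_at_slice: "reslice s N (at_slice s N)"
  by (simp add: reslice_def)

lemma has_slice_indicators_in_slice: "has_slice_indicators n t N \<Longrightarrow> in_slice n t N"
  unfolding has_slice_indicators_def in_slice_def
proof (intro ballI allI impI)
  fix v x b
  assume bij: "bij_betw (label N) (indicators N) {Indicator x b | x b. x \<in> slice_vars n t}"
    and v: "v \<in> nodes N" "label N v = Indicator x b"
  then have "v \<in> indicators N"
    by (simp add: indicators_def)
  with bij have "label N v \<in> {Indicator x b | x b. x \<in> slice_vars n t}"
    by (rule bij_betw_apply)
  with v show "x \<in> slice_vars n t"
    by auto
qed

lemma in_slice_no_indicators: "indicators N = {} \<Longrightarrow> in_slice n t N"
  by (auto simp: in_slice_def indicators_def)

lemma reslice_no_indicators: "indicators N = {} \<Longrightarrow> reslice s N N"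
proof -
  assume "indicators N = {}"
  then have "label N v = set_slice s (label N v)" if "v \<in> nodes N" for v
    using that by (cases "label N v") (auto simp: indicators_def)
  then show ?thesis
    by (simp add: reslice_def)
qed

lemma reslice_inputs: "reslice s N N' \<Longrightarrow> inputs N' = inputs N"
  by (auto simp: reslice_def inputs_def)

lemma reslice_in_slice:
  assumes "reslice s N N'" "in_slice n t N"
  shows "in_slice n s N'"
  unfolding in_slice_def
proof (intro ballI allI impI)
  fix v x b assume "v \<in> nodes N'" "label N' v = Indicator x b"
  then have v: "v \<in> nodes N" "set_slice s (label N v) = Indicator x b"
    using assms(1) by (auto simp: reslice_def)
  then obtain a r where "label N v = Indicator (a, r) b" "x = (a, s)"
    by (cases "(s, label N v)" rule: set_slice.cases) auto
  with v(1) assms(2) show "x \<in> slice_vars n s"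
    by (auto simp: in_slice_def slice_vars_def)
qed

section \<open>Scopes as input scopes plus slice variables\<close>

definition reach_inputs :: "'v network \<Rightarrow> 'v \<Rightarrow> 'v set" where
  "reach_inputs N v = {i \<in> inputs N. (v, i) \<in> (arcs N)\<^sup>*}"

text \<open>The slice number is dropped, so that the set is the same for every resliced
  copy.\<close>

definition reach_indices :: "'v network \<Rightarrow> 'v \<Rightarrow> nat set" where
  "reach_indices N v = {a. \<exists>u r b. (v, u) \<in> (arcs N)\<^sup>* \<and> u \<in> nodes N \<and> label N u = Indicator (a, r) b}"

text \<open>Only the first part involves \<sigma> and only the second involves \<open>t\<close>, so
  the input scopes and the slice can be exchanged separately.\<close>

lemma scope_split:
  assumes "arcs N \<subseteq> nodes N \<times> nodes N" "in_slice n t N" "v \<in> nodes N"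
  shows "scope \<sigma> N v = (\<Union>i \<in> reach_inputs N v. \<sigma> i) \<union> reach_indices N v \<times> {t}"
    (is "_ = ?R")
proof
  have reach: "u \<in> nodes N" if "(v, u) \<in> (arcs N)\<^sup>*" for u
    using that assms(1,3) by (induction rule: rtrancl_induct) auto
  show "scope \<sigma> N v \<subseteq> ?R"
  proof
    fix x assume "x \<in> scope \<sigma> N v"
    then obtain u where u: "(v, u) \<in> (arcs N)\<^sup>*" "x \<in> leaf_scope \<sigma> N u"
      by (auto simp: scope_def)
    with reach[OF u(1)] assms(2) show "x \<in> ?R"
      by (cases "label N u")
        (auto simp: leaf_scope_def in_slice_def reach_inputs_def reach_indices_def inputs_def
          slice_vars_def)
  qed
  show "?R \<subseteq> scope \<sigma> N v"
  proof
    fix x assume "x \<in> ?R"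
    then consider i where "i \<in> inputs N" "(v, i) \<in> (arcs N)\<^sup>*" "x \<in> \<sigma> i"
      | a u r b where "x = (a, t)" "(v, u) \<in> (arcs N)\<^sup>*" "u \<in> nodes N" "label N u = Indicator (a, r) b"
      by (auto simp: reach_inputs_def reach_indices_def)
    then show "x \<in> scope \<sigma> N v"
    proof cases
      case 1
      then show ?thesis
        by (auto simp: scope_def leaf_scope_def inputs_def)
    next
      case 2
      then have "r = t"
        using assms(2) by (auto simp: in_slice_def slice_vars_def)
      with 2 show ?thesis
        by (auto simp: scope_def leaf_scope_def intro!: exI[of _ u])
    qed
  qed
qed

lemma reach_indices_in_slice: "in_slice n t N \<Longrightarrow> reach_indices N v \<subseteq> {1..n}"
  by (auto simp: reach_indices_def in_slice_def slice_vars_def)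

lemma reslice_reach_inputs: "reslice s N N' \<Longrightarrow> reach_inputs N' v = reach_inputs N v"
  by (simp add: reach_inputs_def reslice_inputs) (simp add: reslice_def)

lemma set_slice_eq_Indicator:
  "(\<exists>r b. set_slice s l = Indicator (a, r) b) \<longleftrightarrow> (\<exists>r b. l = Indicator (a, r) b)"
  by (cases "(s, l)" rule: set_slice.cases) auto

lemma reslice_reach_indices: "reslice s N N' \<Longrightarrow> reach_indices N' v = reach_indices N v"
  using set_slice_eq_Indicator[of s] unfolding reach_indices_def reslice_def by auto metis+

text \<open>Each alternative couples both assignments, so within either of them any two scopes are
  equal or disjoint. If the scopes of one assignment are nonempty, its alternatives exclude each
  other and decide the relation in the other.\<close>

definition same_pattern :: "'v set \<Rightarrow> ('v \<Rightarrow> var set) \<Rightarrow> ('v \<Rightarrow> var set) \<Rightarrow> bool" where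
  "same_pattern I \<sigma> \<sigma>' \<longleftrightarrow> (\<forall>i \<in> I. \<forall>j \<in> I.
     (\<sigma> i = \<sigma> j \<and> \<sigma>' i = \<sigma>' j) \<or> (\<sigma> i \<inter> \<sigma> j = {} \<and> \<sigma>' i \<inter> \<sigma>' j = {}))"

text \<open>A point of \<open>\<sigma> i\<close> with \<open>i\<close> in \<open>A\<close> lies in
  some \<open>\<sigma> j\<close> with \<open>j\<close> in \<open>B\<close>. These scopes are then
  not disjoint, which forces the alternative containing
  \<open>\<sigma>' i = \<sigma>' j\<close>.\<close>

lemma same_pattern_Union_subset:
  assumes "same_pattern I \<sigma> \<sigma>'" "\<forall>i \<in> I. \<sigma> i \<noteq> {}" "A \<subseteq> I" "B \<subseteq> I"
    and "(\<Union>i \<in> A. \<sigma> i) \<subseteq> (\<Union>i \<in> B. \<sigma> i)"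
  shows "(\<Union>i \<in> A. \<sigma>' i) \<subseteq> (\<Union>i \<in> B. \<sigma>' i)"
proof (rule UN_least)
  fix i assume i: "i \<in> A"
  with assms obtain x where "x \<in> \<sigma> i"
    by blast
  with i assms(5) obtain j where "j \<in> B" "x \<in> \<sigma> j"
    by blast
  with i \<open>x \<in> \<sigma> i\<close> assms(1,3,4) have "\<sigma>' i = \<sigma>' j"
    unfolding same_pattern_def by blast
  with \<open>j \<in> B\<close> show "\<sigma>' i \<subseteq> (\<Union>i \<in> B. \<sigma>' i)"
    by blast
qed

text \<open>\<open>X\<close> will be the set of slice variables: input scopes lie outside it,
  indicator variables inside.\<close>

lemma Un_subset_separate:
  assumes "A \<union> B \<subseteq> C \<union> D" "A \<inter> X = {}" "C \<inter> X = {}" "B \<subseteq> X" "D \<subseteq> X"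
  shows "A \<subseteq> C \<and> B \<subseteq> D"
  using assms by blast

text \<open>The unprimed data is the reference, where relations between scopes are known; the primed
  data is a copy with other input scopes and another slice, to which these relations are carried
  over.\<close>

locale scope_transfer =
  fixes n t s :: nat and N N' :: "'v network" and \<sigma> \<sigma>' :: "'v \<Rightarrow> var set"
  assumes arcs_N: "arcs N \<subseteq> nodes N \<times> nodes N"
    and in_slice: "in_slice n t N"
    and reslice: "reslice s N N'"
    and pattern: "same_pattern (inputs N) \<sigma> \<sigma>'"
    and nonempty: "\<forall>i \<in> inputs N. \<sigma> i \<noteq> {}"
    and avoid: "\<forall>i \<in> inputs N. \<sigma> i \<inter> slice_vars n t = {}"
    and avoid': "\<forall>i \<in> inputs N. \<sigma>' i \<inter> slice_vars n s = {}"
begin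

lemma scope_old:
  "v \<in> nodes N \<Longrightarrow> scope \<sigma> N v = (\<Union>i \<in> reach_inputs N v. \<sigma> i) \<union> reach_indices N v \<times> {t}"
  using scope_split[OF arcs_N in_slice] .

lemma scope_new:
  assumes "v \<in> nodes N"
  shows "scope \<sigma>' N' v = (\<Union>i \<in> reach_inputs N v. \<sigma>' i) \<union> reach_indices N v \<times> {s}"
proof -
  have "arcs N' \<subseteq> nodes N' \<times> nodes N'" "v \<in> nodes N'"
    using assms arcs_N reslice by (auto simp: reslice_def)
  from scope_split[OF this(1) reslice_in_slice[OF reslice in_slice] this(2)] show ?thesis
    by (simp add: reslice_reach_inputs[OF reslice] reslice_reach_indices[OF reslice])
qed

lemma indices_slice: "reach_indices N v \<times> {r} \<subseteq> slice_vars n r"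
  using reach_indices_in_slice[OF in_slice] by (auto simp: slice_vars_def)

lemma reach_inputs_subset: "reach_inputs N v \<subseteq> inputs N"
  by (auto simp: reach_inputs_def)

lemma inputs_avoid:
  "(\<Union>i \<in> reach_inputs N v. \<sigma> i) \<inter> slice_vars n t = {}"
  "(\<Union>i \<in> reach_inputs N v. \<sigma>' i) \<inter> slice_vars n s = {}"
  using avoid avoid' reach_inputs_subset by blast+

text \<open>The inclusion splits along the slice variables into one for inputs, carried over by the
  pattern, and one for indices, which do not change. Equality then follows by antisymmetry.\<close>

lemma scope_subset_transfer:
  assumes "c \<in> nodes N" "d \<in> nodes N" "scope \<sigma> N c \<subseteq> scope \<sigma> N d"
  shows "scope \<sigma>' N' c \<subseteq> scope \<sigma>' N' d"
proof -
  have "(\<Union>i \<in> reach_inputs N c. \<sigma> i) \<subseteq> (\<Union>i \<in> reach_inputs N d. \<sigma> i) \<and>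
      reach_indices N c \<times> {t} \<subseteq> reach_indices N d \<times> {t}"
    using assms(3) unfolding scope_old[OF assms(1)] scope_old[OF assms(2)]
    by (rule Un_subset_separate[where X = "slice_vars n t"]) (fact inputs_avoid indices_slice)+
  then have "(\<Union>i \<in> reach_inputs N c. \<sigma>' i) \<subseteq> (\<Union>i \<in> reach_inputs N d. \<sigma>' i)"
      and "reach_indices N c \<subseteq> reach_indices N d"
    using same_pattern_Union_subset[OF pattern nonempty reach_inputs_subset reach_inputs_subset] by auto
  then show ?thesis
    unfolding scope_new[OF assms(1)] scope_new[OF assms(2)] by (intro Un_mono Sigma_mono) auto
qed

lemma scope_eq_transfer:
  assumes "c \<in> nodes N" "d \<in> nodes N" "scope \<sigma> N c = scope \<sigma> N d"
  shows "scope \<sigma>' N' c = scope \<sigma>' N' d"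
  using assms scope_subset_transfer by (metis subset_antisym order_refl)

lemma scope_disjoint_transfer:
  assumes "c \<in> nodes N" "d \<in> nodes N" "scope \<sigma> N c \<inter> scope \<sigma> N d = {}"
  shows "scope \<sigma>' N' c \<inter> scope \<sigma>' N' d = {}"
proof -
  have disj: "\<sigma>' i \<inter> \<sigma>' j = {}" if "i \<in> reach_inputs N c" "j \<in> reach_inputs N d" for i j
  proof -
    have "i \<in> inputs N" "j \<in> inputs N" "\<sigma> i \<inter> \<sigma> j = {}"
      using that assms reach_inputs_subset by (auto simp: scope_old)
    \<comment> \<open>Were the two scopes equal, \<open>\<sigma> i\<close> would be disjoint from
      itself and hence empty.\<close>
    with nonempty pattern show ?thesis
      unfolding same_pattern_def by (metis inf.idem)
  qed
  have "reach_indices N c \<inter> reach_indices N d = {}"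
    using assms by (auto simp: scope_old)
  then have "reach_indices N c \<times> {s} \<inter> reach_indices N d \<times> {s} = {}"
    by blast
  moreover have "(\<Union>i \<in> reach_inputs N c. \<sigma>' i) \<inter> (\<Union>j \<in> reach_inputs N d. \<sigma>' j) = {}"
    using disj by blast
  \<comment> \<open>The mixed intersections vanish because the new input scopes avoid the slice
    \<open>s\<close>.\<close>
  moreover have "(\<Union>i \<in> reach_inputs N c. \<sigma>' i) \<inter> reach_indices N d \<times> {s} = {}"
    using inputs_avoid(2)[of c] indices_slice[of d s] by blast
  moreover have "reach_indices N c \<times> {s} \<inter> (\<Union>j \<in> reach_inputs N d. \<sigma>' j) = {}"
    using inputs_avoid(2)[of d] indices_slice[of c s] by blast
  ultimately show ?thesis
    unfolding scope_new[OF assms(1)] scope_new[OF assms(2)] Int_Un_distrib Int_Un_distrib2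
    by (simp only: Un_empty_left)
qed

lemma label_new:
  "v \<in> nodes N \<Longrightarrow> l \<in> {SumNode, ProdNode} \<Longrightarrow> label N' v = l \<Longrightarrow> label N v = l"
  using reslice unfolding reslice_def by (cases "(s, label N v)" rule: set_slice.cases) auto

lemma complete_transfer:
  assumes "complete_net \<sigma> N"
  shows "complete_net \<sigma>' N'"
  unfolding complete_net_def
proof (intro ballI impI allI, elim conjE)
  fix v c d assume "v \<in> nodes N'" "label N' v = SumNode" "(v, c) \<in> arcs N'" "(v, d) \<in> arcs N'"
  then have v: "v \<in> nodes N" "label N v = SumNode" "(v, c) \<in> arcs N" "(v, d) \<in> arcs N"
    using reslice label_new by (auto simp: reslice_def)
  with assms have "scope \<sigma> N c = scope \<sigma> N d"
    unfolding complete_net_def by blast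
  with v arcs_N show "scope \<sigma>' N' c = scope \<sigma>' N' d"
    by (intro scope_eq_transfer) auto
qed

lemma decomposable_transfer:
  assumes "decomposable_net \<sigma> N"
  shows "decomposable_net \<sigma>' N'"
  unfolding decomposable_net_def
proof (intro ballI impI allI, elim conjE)
  fix v c d assume "v \<in> nodes N'" "label N' v = ProdNode" "(v, c) \<in> arcs N'" "(v, d) \<in> arcs N'"
    and "c \<noteq> d"
  then have v: "v \<in> nodes N" "label N v = ProdNode" "(v, c) \<in> arcs N" "(v, d) \<in> arcs N"
    using reslice label_new by (auto simp: reslice_def)
  with assms \<open>c \<noteq> d\<close> have "scope \<sigma> N c \<inter> scope \<sigma> N d = {}"
    unfolding decomposable_net_def by blast
  with v arcs_N show "scope \<sigma>' N' c \<inter> scope \<sigma>' N' d = {}"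
    by (intro scope_disjoint_transfer) auto
qed

end

section \<open>The tower\<close>

text \<open>Finiteness and acyclicity make the converse of the arc relation well-founded, which
  allows induction from children to parents.\<close>

lemma leaf_reachable:
  assumes "is_network N" "v \<in> nodes N"
  shows "\<exists>u \<in> leaves N. (v, u) \<in> (arcs N)\<^sup>*"
proof -
  have "finite (arcs N)" "acyclic (arcs N)"
    using assms(1) by (auto simp: is_network_def intro: finite_subset)
  then have "wf ((arcs N)\<inverse>)"
    by (rule finite_acyclic_wf_converse)
  then show ?thesis
    using assms(2)
  proof (induction v rule: wf_induct_rule)
    case (less v)
    show ?case
    proof (cases "v \<in> leaves N")
      case False
      then obtain w where w: "(v, w) \<in> arcs N"
        using less.prems by (auto simp: leaves_def)
      then have "w \<in> nodes N"
        using assms(1) by (auto simp: is_network_def)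
      with less.IH[of w] w show ?thesis
        by (auto intro: converse_rtrancl_into_rtrancl)
    qed auto
  qed
qed

text \<open>Some leaf is reachable, and without inputs it is an indicator. Applied to the bottom
  network, this keeps equal and disjoint interface scopes apart.\<close>

lemma scope_nonempty:
  assumes "is_network N" "inputs N = {}" "v \<in> nodes N"
  shows "scope \<sigma> N v \<noteq> {}"
proof -
  obtain u where u: "u \<in> leaves N" "(v, u) \<in> (arcs N)\<^sup>*"
    using leaf_reachable[OF assms(1,3)] by blast
  then have "u \<in> indicators N"
    using assms by (auto simp: is_network_def)
  then have "leaf_scope \<sigma> N u \<noteq> {}"
    by (auto simp: leaf_scope_def indicators_def)
  with u show ?thesis
    by (auto simp: scope_def)
qed

text \<open>Serves freshness: a tower with \<open>m\<close> copies uses slices up to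
  \<open>m + 1\<close>, so nodes tagged \<open>m + 2\<close> are new, and \<open>TopNode\<close> is
  new to every tower.\<close>

definition up_to_slice :: "nat \<Rightarrow> ('a, 'b, 'c) dspn_node set" where
  "up_to_slice s = {v. case v of BotNode _ \<Rightarrow> True | TemplateNode r _ \<Rightarrow> r \<le> s | TopNode _ \<Rightarrow> False}"

lemma up_to_slice_simps [simp]:
  "BotNode a \<in> up_to_slice s" "TemplateNode r b \<in> up_to_slice s \<longleftrightarrow> r \<le> s" "TopNode c \<notin> up_to_slice s"
  by (simp_all add: up_to_slice_def)

lemma up_to_slice_Suc: "v \<in> up_to_slice s \<Longrightarrow> v \<in> up_to_slice (Suc s)"
  by (cases v) auto

lemma iface_up_to_slice: "iface g f P m i \<in> up_to_slice (Suc m)"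
  by (induction m arbitrary: i) (auto simp: place_def up_to_slice_Suc)

lemma nodes_tower: "nodes (tower g f B P m :: ('a, 'b, 'c) dspn_node network) \<subseteq> up_to_slice (Suc m)"
  (is "nodes (?tower m) \<subseteq> _")
proof (induction m)
  case (Suc m)
  have "(place P (iface g f P m) (TemplateNode (m + 2)) v :: ('a, 'b, 'c) dspn_node)
      \<in> up_to_slice (Suc (Suc m))" for v
    by (simp add: place_def iface_up_to_slice up_to_slice_Suc)
  moreover have "nodes (?tower m) \<subseteq> up_to_slice (Suc (Suc m))"
    using Suc up_to_slice_Suc by blast
  ultimately show ?case
    by (simp add: stack_def image_net_def image_subset_iff)
qed (auto simp: image_net_def)

section \<open>Interface scopes and validity of the tower\<close>

locale invariant_template =
  fixes n k t :: nat and B :: "'a network" and P :: "'b network" and f :: "'b \<Rightarrow> 'b" and g :: "'b \<Rightarrow> 'a"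
  assumes bottom: "is_bottom n k B"
    and template: "is_template n k t P f"
    and g: "bij_betw g (inputs P) (roots B)"
    and complete_bottom: "complete_net no_inputs B"
    and decomposable_bottom: "decomposable_net no_inputs B"
    and invariant: "invariant n t (\<lambda>i. scope no_inputs B (g i)) P f"
begin

abbreviation bottom_scope :: "'b \<Rightarrow> var set" where
  "bottom_scope i \<equiv> scope no_inputs B (g i)"

text \<open>The type \<open>'c\<close> occurs in the node type of the tower but in none of the data
  it is built from; the \<open>itself\<close> argument fixes it.\<close>

abbreviation iface_scope :: "'c itself \<Rightarrow> nat \<Rightarrow> 'b \<Rightarrow> var set" where
  "iface_scope _ m i \<equiv>
     scope no_inputs (tower g f B P m :: ('a, 'b, 'c) dspn_node network) (iface g f P m i)"

lemma g_nodes: "g ` inputs P \<subseteq> nodes B"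
  using g by (auto simp: bij_betw_def roots_def)

lemma f_nodes: "f ` inputs P \<subseteq> nodes P"
  using template by (auto simp: is_template_def bij_betw_def roots_def)

lemma network_P: "is_network P"
  using template by (simp add: is_template_def)

lemma network_at_slice: "is_network (at_slice s P)"
proof -
  have "set_slice s l = SumNode \<longleftrightarrow> l = SumNode" for l
    by (cases "(s, l)" rule: set_slice.cases) auto
  moreover have "(\<exists>x b. set_slice s l = Indicator x b) \<longleftrightarrow> (\<exists>x b. l = Indicator x b)" for l
    by (cases "(s, l)" rule: set_slice.cases) auto
  then have "indicators (at_slice s P) = indicators P"
    by (simp add: indicators_def)
  ultimately show ?thesis
    using network_P by (simp add: is_network_def leaves_def)
qed

lemma stacking_bottom: "stacking BotNode B empty_net"
  using bottom by (auto simp: is_bottom_def intro!: stacking_empty_net injI)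

lemma tower_0: "tower g f B P 0 = stack BotNode B empty_net"
  by (simp add: image_net_eq_stack)

lemma stacking_tower:
  defines "L \<equiv> \<lambda>m. tower g f B P m :: ('a, 'b, 'c) dspn_node network"
  assumes "arcs (L m) \<subseteq> nodes (L m) \<times> nodes (L m)"
  shows "stacking (place P (iface g f P m) (TemplateNode (m + 2))) (at_slice (m + 2) P) (L m)"
proof -
  \<comment> \<open>\<open>stacking_place\<close> uses \<open>place\<close> for the stacked network,
    the tower uses it for \<open>P\<close>. Both agree because \<open>place\<close> consults only
    the inputs, which reslicing keeps.\<close>
  have "stacking (place (at_slice (m + 2) P) (iface g f P m) (TemplateNode (m + 2)))
      (at_slice (m + 2) P) (L m)"
  proof (rule stacking_place)
    show "is_network (at_slice (m + 2) P)"
      by (rule network_at_slice)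
    show "iface g f P m ` inputs (at_slice (m + 2) P) \<subseteq> nodes (L m)"
      using iface_in_tower[OF g_nodes f_nodes] by (auto simp: L_def)
    show "inj (TemplateNode (m + 2))"
      by (auto intro: injI)
    have "v \<in> up_to_slice (Suc m)" if "v \<in> nodes (L m)" for v
      using that nodes_tower unfolding L_def by blast
    then show "range (TemplateNode (m + 2)) \<inter> nodes (L m) = {}"
      by fastforce
  qed fact
  then show ?thesis
    by (simp add: place_def[abs_def])
qed

lemma arcs_tower: "arcs (tower g f B P m) \<subseteq> nodes (tower g f B P m) \<times> nodes (tower g f B P m)"
proof (induction m)
  case 0
  show ?case
    unfolding tower_0 by (rule stacking.arcs_S_subset[OF stacking_bottom])
next
  case (Suc m)
  show ?case
    unfolding tower.simps by (rule stacking.arcs_S_subset[OF stacking_tower[OF Suc]])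
qed

lemma scope_iface_0: "i \<in> inputs P \<Longrightarrow> iface_scope TYPE('c) 0 i = bottom_scope i"
  unfolding tower_0 iface.simps
  using bottom g_nodes by (intro stacking.scope_upper[OF stacking_bottom]) (auto simp: is_bottom_def)

text \<open>The node \<open>f i\<close> may itself be an input, and then the interface node is one
  of the level below; \<open>scope_upper\<close> covers both cases.\<close>

lemma scope_iface_Suc:
  assumes "i \<in> inputs P"
  shows "iface_scope TYPE('c) (Suc m) i = scope (iface_scope TYPE('c) m) (at_slice (m + 2) P) (f i)"
  unfolding tower.simps iface.simps
  using assms f_nodes by (intro stacking.scope_upper[OF stacking_tower[OF arcs_tower]]) (auto simp: place_def)

lemma bottom_nonempty: "i \<in> inputs P \<Longrightarrow> bottom_scope i \<noteq> {}"
  using bottom g_nodes scope_nonempty[of B "g i" no_inputs] by (auto simp: is_bottom_def)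

lemma scope_input: "i \<in> inputs P \<Longrightarrow> scope \<sigma> P i = \<sigma> i"
  using network_P by (subst scope_leaf) (auto simp: is_network_def leaf_scope_def inputs_def)

lemma bottom_avoid: "i \<in> inputs P \<Longrightarrow> bottom_scope i \<inter> slice_vars n t = {}"
  using invariant scope_input[of i bottom_scope] by (auto simp: invariant_def)

lemma invariant_scopes:
  assumes "i \<in> inputs P" "j \<in> inputs P"
  shows "bottom_scope i = bottom_scope j \<or> bottom_scope i \<inter> bottom_scope j = {}"
    and "bottom_scope i = bottom_scope j \<longleftrightarrow> scope bottom_scope P (f i) = scope bottom_scope P (f j)"
    and "bottom_scope i \<inter> bottom_scope j = {} \<longleftrightarrow>
      scope bottom_scope P (f i) \<inter> scope bottom_scope P (f j) = {}"
  using invariant[unfolded invariant_def, THEN conjunct2, THEN conjunct1, THEN bspec, THEN bspec, OF assms]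
  unfolding scope_input[OF assms(1)] scope_input[OF assms(2)] by - (elim conjE, assumption)+

lemma bottom_slice:
  assumes "i \<in> inputs P"
  shows "bottom_scope i \<subseteq> slice_vars n 1"
proof -
  have "arcs B \<subseteq> nodes B \<times> nodes B" "in_slice n 1 B" "inputs B = {}"
    using bottom by (auto simp: is_bottom_def is_network_def dest: has_slice_indicators_in_slice)
  then show ?thesis
    using assms g_nodes reach_indices_in_slice[of n 1 B "g i"]
    by (subst scope_split[of _ n 1]) (auto simp: reach_inputs_def slice_vars_def)
qed

text \<open>The reference is always the original template over the bottom scopes, where invariance
  is assumed, so invariance is never proved again for a copy. The interface scopes below the copy
  use slices up to \<open>m + 1\<close> and thus avoid its slice \<open>m + 2\<close>.\<close>

lemma transfer_template:
  assumes "same_pattern (inputs P) bottom_scope (iface_scope TYPE('c) m)"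
    and "\<forall>i \<in> inputs P. iface_scope TYPE('c) m i \<subseteq> {1..n} \<times> {1..m + 1}"
  shows "scope_transfer n t (m + 2) P (at_slice (m + 2) P) bottom_scope (iface_scope TYPE('c) m)"
proof
  show "arcs P \<subseteq> nodes P \<times> nodes P"
    using network_P by (simp add: is_network_def)
  show "in_slice n t P"
    using template by (simp add: is_template_def has_slice_indicators_in_slice)
  have "{1..n} \<times> {1..m + 1} \<inter> slice_vars n (m + 2) = {}"
    by (auto simp: slice_vars_def)
  then show "\<forall>i \<in> inputs P. iface_scope TYPE('c) m i \<inter> slice_vars n (m + 2) = {}"
    using assms(2) by blast
qed (use bottom_nonempty bottom_avoid in \<open>auto intro: assms(1) reslice_at_slice\<close>)

text \<open>Both claims go through one induction, since the transfer through the next copy requires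
  the pattern as well as the slice bound.\<close>

lemma iface_scopes:
  "same_pattern (inputs P) bottom_scope (iface_scope TYPE('c) m) \<and>
   (\<forall>i \<in> inputs P. iface_scope TYPE('c) m i \<subseteq> {1..n} \<times> {1..m + 1})"
proof (induction m)
  case 0
  show ?case
    using invariant_scopes(1) bottom_slice
    by (auto simp: same_pattern_def scope_iface_0 slice_vars_def simp del: tower.simps iface.simps)
next
  case (Suc m)
  interpret scope_transfer n t "m + 2" P "at_slice (m + 2) P" bottom_scope "iface_scope TYPE('c) m"
    using Suc by (intro transfer_template) auto
  have "same_pattern (inputs P) bottom_scope (iface_scope TYPE('c) (Suc m))"
    unfolding same_pattern_def
  proof (intro ballI)
    fix i j assume ij: "i \<in> inputs P" "j \<in> inputs P"
    then have nodes: "f i \<in> nodes P" "f j \<in> nodes P"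
      using f_nodes by auto
    show "bottom_scope i = bottom_scope j \<and> iface_scope TYPE('c) (Suc m) i = iface_scope TYPE('c) (Suc m) j \<or>
        bottom_scope i \<inter> bottom_scope j = {} \<and> iface_scope TYPE('c) (Suc m) i \<inter> iface_scope TYPE('c) (Suc m) j = {}"
      \<comment> \<open>The two equivalences of invariance turn the relation between the bottom
        scopes of \<open>i\<close> and \<open>j\<close> into the same relation between
        \<open>f i\<close> and \<open>f j\<close> in the reference template; the transfer carries it
        to the copy.\<close>
      using invariant_scopes[OF ij] scope_eq_transfer[OF nodes] scope_disjoint_transfer[OF nodes]
      unfolding scope_iface_Suc[OF ij(1)] scope_iface_Suc[OF ij(2)] by blast
  qed
  moreover have "iface_scope TYPE('c) (Suc m) i \<subseteq> {1..n} \<times> {1..Suc m + 1}" if "i \<in> inputs P" for i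
  proof -
    have "f i \<in> nodes P"
      using f_nodes that by auto
    \<comment> \<open>What arrives through the inputs stays within slices up to
      \<open>m + 1\<close>; the indicators of the copy add slice \<open>m + 2\<close>.\<close>
    moreover have "(\<Union>j \<in> reach_inputs P (f i). iface_scope TYPE('c) m j) \<subseteq> {1..n} \<times> {1..Suc m + 1}"
      using Suc reach_inputs_subset[of "f i"] by fastforce
    moreover have "reach_indices P (f i) \<times> {m + 2} \<subseteq> {1..n} \<times> {1..Suc m + 1}"
      using indices_slice[of "f i" "m + 2"] by (auto simp: slice_vars_def)
    ultimately show ?thesis
      unfolding scope_iface_Suc[OF that] by (simp only: scope_new Un_least)
  qed
  ultimately show ?case
    by blast
qed

lemma tower_complete_decomposable:
  fixes m
  defines "L \<equiv> tower g f B P m :: ('a, 'b, 'c) dspn_node network"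
  shows "complete_net no_inputs L \<and> decomposable_net no_inputs L"
  unfolding L_def
proof (induction m)
  case 0
  show ?case
    unfolding tower_0
    using bottom complete_bottom decomposable_bottom
    by (intro conjI stacking.complete_stack[OF stacking_bottom]
        stacking.decomposable_stack[OF stacking_bottom]) (auto simp: is_bottom_def)
next
  case (Suc m)
  \<comment> \<open>The transfer turns the completeness and decomposability contained in invariance
    into those of the copy over the scopes it receives in the tower.\<close>
  interpret scope_transfer n t "m + 2" P "at_slice (m + 2) P" bottom_scope "iface_scope TYPE('c) m"
    using iface_scopes by (intro transfer_template) auto
  show ?case
    unfolding tower.simps
    using Suc invariant complete_transfer decomposable_transfer
    by (intro conjI stacking.complete_stack[OF stacking_tower[OF arcs_tower], where \<sigma> = "iface_scope TYPE('c) m"]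
        stacking.decomposable_stack[OF stacking_tower[OF arcs_tower], where \<sigma> = "iface_scope TYPE('c) m"])
      (auto simp: invariant_def place_def)
qed

section \<open>Capping the tower with the top network\<close>

lemma dspn_complete_decomposable:
  fixes R :: "'c network"
  assumes top: "is_top k R" and h: "h ` inputs R \<subseteq> inputs P"
    and "complete_net (\<lambda>i. bottom_scope (h i)) R" "decomposable_net (\<lambda>i. bottom_scope (h i)) R"
  shows "complete_net no_inputs (dspn g f h B P R T) \<and> decomposable_net no_inputs (dspn g f h B P R T)"
proof -
  \<comment> \<open>Of the slices, the first belongs to the bottom network, so the top network rests
    on \<open>T - 1\<close> template copies.\<close>
  let ?\<sigma> = "iface_scope TYPE('c) (T - 1)"
  have pattern: "same_pattern (inputs P) bottom_scope ?\<sigma>"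
    and slices: "\<forall>i \<in> inputs P. ?\<sigma> i \<subseteq> {1..n} \<times> {1..T - 1 + 1}"
    using iface_scopes by auto
  \<comment> \<open>The top network has no indicators, so it may be placed in the unused slice 0.\<close>
  interpret scope_transfer n 0 0 R R "\<lambda>i. bottom_scope (h i)" "\<lambda>i. ?\<sigma> (h i)"
  proof
    show "same_pattern (inputs R) (\<lambda>i. bottom_scope (h i)) (\<lambda>i. ?\<sigma> (h i))"
      using pattern h unfolding same_pattern_def by blast
    have "{1..n} \<times> {1..T - 1 + 1} \<inter> slice_vars n 0 = {}" "slice_vars n 1 \<inter> slice_vars n 0 = {}"
      by (auto simp: slice_vars_def)
    then show "\<forall>i \<in> inputs R. ?\<sigma> (h i) \<inter> slice_vars n 0 = {}"
      and "\<forall>i \<in> inputs R. bottom_scope (h i) \<inter> slice_vars n 0 = {}"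
      using slices bottom_slice h by blast+
  qed (use top h bottom_nonempty in
      \<open>auto simp: is_top_def is_network_def in_slice_no_indicators reslice_no_indicators\<close>)
  let ?L = "tower g f B P (T - 1) :: ('a, 'b, 'c) dspn_node network"
  have stacking: "stacking (place R (iface g f P (T - 1) \<circ> h) TopNode) R ?L"
  proof (rule stacking_place)
    show "is_network R"
      using top by (simp add: is_top_def)
    show "(iface g f P (T - 1) \<circ> h) ` inputs R \<subseteq> nodes ?L"
      using h iface_in_tower[OF g_nodes f_nodes] by auto
    show "inj TopNode"
      by (auto intro: injI)
    have "v \<in> up_to_slice (Suc (T - 1))" if "v \<in> nodes ?L" for v
      using that nodes_tower by blast
    then show "range TopNode \<inter> nodes ?L = {}"
      by fastforce
  qed (rule arcs_tower)
  show ?thesis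
    unfolding dspn_def
    using tower_complete_decomposable assms(3,4) complete_transfer decomposable_transfer
    by (intro conjI stacking.complete_stack[OF stacking, where \<sigma> = "\<lambda>i. ?\<sigma> (h i)"]
        stacking.decomposable_stack[OF stacking, where \<sigma> = "\<lambda>i. ?\<sigma> (h i)"])
      (auto simp: place_def)
qed

end

theorem theorem8:
  fixes n k t T :: nat
    and B :: "'a network" and P :: "'b network" and R :: "'c network"
    and f :: "'b \<Rightarrow> 'b" and g :: "'b \<Rightarrow> 'a" and h :: "'c \<Rightarrow> 'b"
  assumes "is_bottom n k B"
    and "1 \<le> t" and "is_template n k t P f"
    and "is_top k R"
    and "bij_betw g (inputs P) (roots B)"
    and "bij_betw h (inputs R) (inputs P)"
    and "complete_net no_inputs B" and "decomposable_net no_inputs B"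
    and "\<forall>u \<in> roots B. \<forall>v \<in> roots B.
           scope no_inputs B u = scope no_inputs B v \<or>
           scope no_inputs B u \<inter> scope no_inputs B v = {}"
    and "invariant n t (\<lambda>i. scope no_inputs B (g i)) P f"
    and "complete_net (\<lambda>i. scope no_inputs B (g (h i))) R"
    and "decomposable_net (\<lambda>i. scope no_inputs B (g (h i))) R"
    and "1 \<le> T"
  shows "complete_net no_inputs (dspn g f h B P R T) \<and> decomposable_net no_inputs (dspn g f h B P R T)"
proof -
  interpret invariant_template n k t B P f g
    using assms by unfold_locales
  show ?thesis
    using assms by (intro dspn_complete_decomposable) (auto simp: bij_betw_def)
qed

end
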